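(* Let $n,m,r\ge1$ and $\phi:\mathbb{R}^{n\times r}\times\mathbb{R}^{m\times r}\to\mathbb{R}^{n\times m}$, $\phi(U,V)=UV^\top$. If the vertical concatenation $(U;V)\in\mathbb{R}^{(n+m)\times r}$ has full rank, denoted $\mathtt{rk}$, then $$\dim\big(\operatorname{Lie}(W_\phi)(U;V)\big)=(n+m)r-\mathtt{rk}\,(2r+1-\mathtt{rk})/2 .$$
   Context: Identify $(U,V)$ with $(U;V)\in\mathbb{R}^{(n+m)\times r}\cong\mathbb{R}^D$, $D=(n+m)r$. $W_\phi$ is the span of the gradient vector fields $\nabla\phi_{k,l}$ of the entries of $\phi$. Smooth vector fields on $\mathbb{R}^D$ form a Lie algebra for $[\chi_1,\chi_2](\theta)=\partial\chi_1(\theta)\chi_2(\theta)-\partial\chi_2(\theta)\chi_1(\theta)$ ($\partial$ the Jacobian), and $\operatorname{Lie}(W_\phi)$ is the smallest Lie subalgebra containing $W_\phi$. Its trace at $\theta$ is $\operatorname{Lie}(W_\phi)(\theta)=\operatorname{span}\{\chi(\theta):\chi\in\operatorname{Lie}(W_\phi)\}\subseteq\mathbb{R}^D$. *)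

theory Defs
  imports "HOL-Analysis.Analysis" "HOL-Library.Function_Algebras"
begin

text \<open>Functions into a real vector space form a real vector space pointwise; the additive
  structure is that of \<^theory>\<open>HOL-Library.Function_Algebras\<close>. This makes \<^const>\<open>span\<close> and
  \<^const>\<open>subspace\<close> available for sets of vector fields.\<close>

instantiation "fun" :: (type, real_vector) real_vector
begin

definition scaleR_fun :: "real \<Rightarrow> ('a \<Rightarrow> 'b) \<Rightarrow> 'a \<Rightarrow> 'b"
  where "scaleR_fun c f = (\<lambda>x. c *\<^sub>R f x)"

instance
  by standard (simp_all add: scaleR_fun_def fun_eq_iff scaleR_add_right scaleR_add_left)

end

text \<open>In finite dimension, a map is \<open>k + 1\<close> times continuously differentiable iff it is
  differentiable and all its directional derivatives are \<open>k\<close> times continuously differentiable.\<close>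

primrec times_cont_differentiable ::
    "nat \<Rightarrow> ('a::euclidean_space \<Rightarrow> 'b::real_normed_vector) \<Rightarrow> bool" where
  "times_cont_differentiable 0 f \<longleftrightarrow> continuous_on UNIV f"
| "times_cont_differentiable (Suc k) f \<longleftrightarrow>
     (\<forall>x. f differentiable (at x)) \<and>
     (\<forall>v. times_cont_differentiable k (\<lambda>x. frechet_derivative f (at x) v))"

definition smooth :: "('a::euclidean_space \<Rightarrow> 'b::real_normed_vector) \<Rightarrow> bool"
  where "smooth f \<longleftrightarrow> (\<forall>k. times_cont_differentiable k f)"

definition gradient :: "('a::real_inner \<Rightarrow> real) \<Rightarrow> 'a \<Rightarrow> 'a"
  where "gradient f x = (THE D. GDERIV f x :> D)"

definition lie_bracket ::
    "('a::euclidean_space \<Rightarrow> 'a) \<Rightarrow> ('a \<Rightarrow> 'a) \<Rightarrow> 'a \<Rightarrow> 'a"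
  where "lie_bracket X Y = (\<lambda>x. frechet_derivative X (at x) (Y x) - frechet_derivative Y (at x) (X x))"

definition lie_subalgebra :: "('a::euclidean_space \<Rightarrow> 'a) set \<Rightarrow> bool"
  where "lie_subalgebra L \<longleftrightarrow>
    L \<subseteq> {X. smooth X} \<and> subspace L \<and> (\<forall>X\<in>L. \<forall>Y\<in>L. lie_bracket X Y \<in> L)"

definition lie_generated :: "('a::euclidean_space \<Rightarrow> 'a) set \<Rightarrow> ('a \<Rightarrow> 'a) set"
  where "lie_generated W = lie_subalgebra hull W"

definition trace_at :: "('a::euclidean_space \<Rightarrow> 'a) set \<Rightarrow> 'a \<Rightarrow> 'a set"
  where "trace_at L x = span {X x |X. X \<in> L}"

text \<open>The identification \<open>(U, V) \<mapsto> (U; V)\<close> and its inverse. Rows of the concatenation are indexed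
  by the sum type, so that the inner product on the concatenations is the standard one
  on \<open>\<real>\<^sup>D\<close>.\<close>

definition vconcat :: "real^'r^'n \<Rightarrow> real^'r^'m \<Rightarrow> real^'r^('n::finite + 'm::finite)"
  where "vconcat U V = (\<chi> i. case i of Inl a \<Rightarrow> U $ a | Inr b \<Rightarrow> V $ b)"

definition upper_block :: "real^'r^('n::finite + 'm::finite) \<Rightarrow> real^'r^'n"
  where "upper_block \<theta> = (\<chi> a. \<theta> $ Inl a)"

definition lower_block :: "real^'r^('n::finite + 'm::finite) \<Rightarrow> real^'r^'m"
  where "lower_block \<theta> = (\<chi> b. \<theta> $ Inr b)"

definition on_concat ::
    "(real^'r^'n \<Rightarrow> real^'r^'m \<Rightarrow> 'c) \<Rightarrow> real^'r^('n::finite + 'm::finite) \<Rightarrow> 'c"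
  where "on_concat f \<theta> = f (upper_block \<theta>) (lower_block \<theta>)"

definition gradient_fields ::
    "(real^'r^'n \<Rightarrow> real^'r^'m \<Rightarrow> real^'q^'p) \<Rightarrow> (real^'r^('n::finite + 'm::finite) \<Rightarrow> real^'r^('n::finite + 'm::finite)) set"
  where "gradient_fields f =
    span {gradient (on_concat (\<lambda>U V. f U V $ k $ l)) |k l. True}"

definition factorization :: "real^'r^'n \<Rightarrow> real^'r^'m \<Rightarrow> real^'m^'n"
  where "factorization U V = U ** transpose V"

end

theory Submission
  imports Defs
begin

text \<open>
  The gradient of the \<open>(k, l)\<close> entry of \<open>U V\<^sup>T\<close> is the linear field \<open>\<theta> \<mapsto> S \<theta>\<close> with
  \<open>S = E\<^sub>k\<^sub>l + E\<^sub>l\<^sub>k\<close>, and the bracket of linear fields is the linear field of the commutator.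
  Commutators of these \<open>S\<close> produce the skew units inside the two diagonal blocks, so
  the generated Lie algebra consists of the fields \<open>\<theta> \<mapsto> M \<theta>\<close> with \<open>M \<in> \<ss>\<oo>(n, m)\<close>, that is, with
  \<open>J M\<close> skew for \<open>J = diag(1, -1)\<close>. Multiplying by \<open>J\<close>, its trace at \<open>\<theta>\<close> has the dimension of
  \<open>{K \<theta> | K skew}\<close>. With \<open>N = n + m\<close> and a set \<open>B\<close> of row indices forming a basis of the row space
  of \<open>\<theta>\<close>, this space is the injective image of the skew \<open>K\<close> that vanish on the complement of \<open>B\<close>,
  whence its dimension is \<open>N(N - 1)/2 - (N - rk)(N - rk - 1)/2\<close> for \<open>\<theta>\<close> of any rank \<open>rk\<close>. Full rank,
  in the form \<open>(N - rk)(r - rk) = 0\<close>, turns this into the stated value.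
\<close>

section \<open>Skew-symmetric matrices applied to a fixed matrix\<close>

definition matrix_unit :: "'n::finite \<Rightarrow> 'm::finite \<Rightarrow> real^'m^'n"
  where "matrix_unit i j = axis i (axis j 1)"

lemma matrix_unit_nth: "matrix_unit i j $ a $ b = (if a = i \<and> b = j then 1 else 0)"
  by (simp add: matrix_unit_def axis_def)

lemma matrix_unit_mult:
  "matrix_unit i j ** matrix_unit k l = (if j = k then matrix_unit i l else 0)"
proof -
  have "(\<Sum>c\<in>UNIV. matrix_unit i j $ a $ c * matrix_unit k l $ c $ b)
      = (if j = k then matrix_unit i l else 0) $ a $ b" for a b
  proof -
    have "(\<Sum>c\<in>UNIV. matrix_unit i j $ a $ c * matrix_unit k l $ c $ b)
        = (\<Sum>c\<in>UNIV. if c = j then matrix_unit i j $ a $ j * matrix_unit k l $ j $ b else 0)"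
      by (rule sum.cong) (auto simp: matrix_unit_nth)
    then show ?thesis
      by (auto simp: matrix_unit_nth)
  qed
  then show ?thesis
    by (simp add: vec_eq_iff matrix_matrix_mult_def)
qed

lemma transpose_matrix_unit: "transpose (matrix_unit i j) = matrix_unit j i"
  by (simp add: vec_eq_iff transpose_def matrix_unit_nth conj_commute)

lemma inner_matrix_unit:
  "inner (matrix_unit i j) (matrix_unit k l) = (if i = k \<and> j = l then 1 else 0)"
  by (simp add: matrix_unit_def inner_axis_axis)

lemma sum_matrix_unit: "A = (\<Sum>i\<in>UNIV. \<Sum>j\<in>UNIV. A $ i $ j *\<^sub>R matrix_unit i j)"
proof -
  have "(\<Sum>j\<in>UNIV. A $ i $ j *\<^sub>R matrix_unit i j) $ a $ b = (if i = a then A $ a $ b else 0)" for i a b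
    by (cases "i = a") (simp_all add: matrix_unit_nth if_distrib cong: if_cong)
  then show ?thesis
    by (simp add: vec_eq_iff sum_component del: vector_scaleR_component)
qed

lemma linear_matrix_mult_left: "linear (\<lambda>A :: real^'n^'m. A ** (B :: real^'k^'n))"
  by (rule linearI)
    (simp_all add: vec_eq_iff matrix_matrix_mult_def sum.distrib sum_distrib_left algebra_simps)

lemma linear_matrix_mult_right: "linear (\<lambda>B :: real^'k^'n. (A :: real^'n^'m) ** B)"
  by (rule linearI)
    (simp_all add: vec_eq_iff matrix_matrix_mult_def sum.distrib sum_distrib_left algebra_simps)

lemma linear_transpose: "linear (transpose :: real^'n^'m \<Rightarrow> real^'m^'n)"
  by (rule linearI) (simp_all add: transpose_def vec_eq_iff)

section \<open>Skew matrices without entries in the complementary diagonal block\<close>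

lemma skew_nth:
  assumes "transpose K = - K"
  shows "K $ i $ j = - K $ j $ i"
proof -
  have "K $ i $ j = transpose K $ j $ i"
    by (simp add: transpose_def)
  then show ?thesis
    by (simp add: assms)
qed

text \<open>The square of all index pairs splits into these pairs, their converses, the diagonal
  over \<open>B\<close> and the square of \<open>- B\<close>. The additive form avoids halving and
  truncated subtraction.\<close>

lemma double_card_strict_pairs_off_square:
  fixes f :: "'n::finite \<Rightarrow> 'b::linorder"
  assumes "inj f"
  shows "2 * card {(i, j). f i < f j \<and> (i \<in> B \<or> j \<in> B)} + card B + card (- B) ^ 2 = CARD('n) ^ 2"
proof -
  let ?P = "{(i, j). f i < f j \<and> (i \<in> B \<or> j \<in> B)}"
  let ?D = "(\<lambda>i. (i, i)) ` B"
  have "(UNIV :: ('n \<times> 'n) set) = (?P \<union> ?P\<inverse>) \<union> (?D \<union> (- B) \<times> (- B))"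
  proof -
    have "f i < f j \<or> f j < f i \<or> i = j" for i j
      using assms by (meson injD linorder_neqE)
    then show ?thesis
      by blast
  qed
  then have "card (UNIV :: ('n \<times> 'n) set) = card ((?P \<union> ?P\<inverse>) \<union> (?D \<union> (- B) \<times> (- B)))"
    by (rule arg_cong)
  also have "\<dots> = card (?P \<union> ?P\<inverse>) + card (?D \<union> (- B) \<times> (- B))"
    by (rule card_Un_disjoint) auto
  also have "card (?P \<union> ?P\<inverse>) = card ?P + card (?P\<inverse>)"
    by (rule card_Un_disjoint) auto
  also have "card (?D \<union> (- B) \<times> (- B)) = card ?D + card ((- B) \<times> (- B))"
    by (rule card_Un_disjoint) auto
  also have "card ?D = card B"
    by (rule card_image) (simp add: inj_on_def)
  also have "card (?P\<inverse>) = card ?P"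
    by (rule card_inverse)
  finally show ?thesis
    by (simp add: card_cartesian_product power2_eq_square)
qed

text \<open>When the rows indexed by \<open>B\<close> form a basis of the row space of
  \<open>Z\<close>, this is a complement, within the skew matrices, of those that annihilate
  \<open>Z\<close>.\<close>

definition skew_vanishing_off :: "'n::finite set \<Rightarrow> (real^'n^'n) set"
  where "skew_vanishing_off B =
    {K. transpose K = - K \<and> (\<forall>i j. i \<notin> B \<longrightarrow> j \<notin> B \<longrightarrow> K $ i $ j = 0)}"

lemma subspace_skew_vanishing_off: "subspace (skew_vanishing_off B)"
  by (rule subspaceI)
    (auto simp: skew_vanishing_off_def linear_0[OF linear_transpose] linear_add[OF linear_transpose]
      linear_cmul[OF linear_transpose])

lemma dim_skew_vanishing_off:
  fixes B :: "'n::finite set"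
  shows "2 * dim (skew_vanishing_off B) + card B + card (- B) ^ 2 = CARD('n) ^ 2"
proof -
  \<comment> \<open>The index type carries no order; an injection into the naturals orients each
    pair of distinct indices.\<close>
  obtain f :: "'n \<Rightarrow> nat" where f: "inj f"
    using ex_bij_betw_finite_nat[OF finite, of "UNIV :: 'n set"] bij_betw_imp_inj_on by metis
  define P where "P = {(i, j). f i < f j \<and> (i \<in> B \<or> j \<in> B)}"
  define g where "g = (\<lambda>(i, j). matrix_unit i j - matrix_unit j i :: real^'n^'n)"
  have inner_g: "inner (g p) (g q) = (if p = q then 2 else 0)" if "p \<in> P" "q \<in> P" for p q
  proof -
    obtain i j k l where pq: "p = (i, j)" "q = (k, l)"
      by (cases p, cases q) blast
    have "f i < f j" "f k < f l"
      using that by (auto simp: P_def pq)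
    \<comment> \<open>The orientation excludes that \<open>q\<close> is \<open>p\<close> reversed,
      the one case where the inner product would be -2.\<close>
    moreover from this have "\<not> (i = l \<and> j = k)" "i \<noteq> j" "k \<noteq> l"
      by auto
    ultimately show ?thesis
      by (simp only: g_def pq prod.case inner_diff_left inner_diff_right inner_matrix_unit prod.inject) auto
  qed
  have "inj_on g P"
    by (rule inj_onI) (metis inner_g zero_neq_numeral)
  moreover have "independent (g ` P)"
  proof (rule pairwise_orthogonal_independent)
    show "pairwise orthogonal (g ` P)"
      by (auto simp: pairwise_def orthogonal_def inner_g)
    show "0 \<notin> g ` P"
      using inner_g by (metis imageE inner_zero_left zero_neq_numeral)
  qed
  moreover have "span (g ` P) = skew_vanishing_off B"
  proof
    have "g ` P \<subseteq> skew_vanishing_off B"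
    proof (rule image_subsetI)
      fix p
      assume "p \<in> P"
      then obtain i j where p: "p = (i, j)" and ij: "i \<in> B \<or> j \<in> B"
        by (cases p) (simp add: P_def)
      have "transpose (g p) = - g p"
        by (simp add: p g_def linear_diff[OF linear_transpose] transpose_matrix_unit)
      moreover have "g p $ a $ b = 0" if "a \<notin> B" "b \<notin> B" for a b
      proof -
        have "\<not> (a = i \<and> b = j)" "\<not> (a = j \<and> b = i)"
          using ij that by blast+
        then show ?thesis
          by (simp only: p g_def prod.case vector_minus_component matrix_unit_nth if_False diff_self)
      qed
      ultimately show "g p \<in> skew_vanishing_off B"
        by (simp add: skew_vanishing_off_def)
    qed
    then show "span (g ` P) \<subseteq> skew_vanishing_off B"
      by (rule span_minimal) (rule subspace_skew_vanishing_off)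
  next
    show "skew_vanishing_off B \<subseteq> span (g ` P)"
    proof
      fix K :: "real^'n^'n"
      assume K: "K \<in> skew_vanishing_off B"
      have "(\<Sum>p\<in>P. K $ fst p $ snd p *\<^sub>R g p) $ a $ b = K $ a $ b" for a b
      proof -
        have "(\<Sum>p\<in>P. K $ fst p $ snd p *\<^sub>R g p) $ a $ b
            = (\<Sum>p\<in>P. (if p = (a, b) then K $ a $ b else 0) - (if p = (b, a) then K $ b $ a else 0))"
          unfolding sum_component
        proof (rule sum.cong[OF refl])
          fix p :: "'n \<times> 'n"
          have "g p $ a $ b = (if p = (a, b) then 1 else 0) - (if p = (b, a) then 1 else 0)"
          proof -
            obtain i j where p: "p = (i, j)"
              by (cases p)
            have "(a = i \<and> b = j) = (p = (a, b))" "(a = j \<and> b = i) = (p = (b, a))"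
              by (auto simp: p)
            then show ?thesis
              by (simp only: g_def p prod.case vector_minus_component matrix_unit_nth)
          qed
          moreover have "K $ fst p $ snd p * (if p = q then 1 else 0) = (if p = q then K $ fst q $ snd q else 0)" for q
            by simp
          ultimately show "(K $ fst p $ snd p *\<^sub>R g p) $ a $ b
              = (if p = (a, b) then K $ a $ b else 0) - (if p = (b, a) then K $ b $ a else 0)"
            by (simp only: vector_scaleR_component real_scaleR_def right_diff_distrib fst_conv snd_conv)
        qed
        also have "\<dots> = (if (a, b) \<in> P then K $ a $ b else 0) - (if (b, a) \<in> P then K $ b $ a else 0)"
          by (simp only: sum_subtractf sum.delta finite)
        \<comment> \<open>At most one of the two pairs lies in \<open>P\<close>. If neither does,
          then either \<open>a = b\<close>, where skewness gives 0, or both indices lie outside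
          \<open>B\<close>.\<close>
        also have "\<dots> = K $ a $ b"
        proof -
          have skew: "K $ b $ a = - K $ a $ b" and zero: "a \<notin> B \<Longrightarrow> b \<notin> B \<Longrightarrow> K $ a $ b = 0"
            using K by (auto simp: skew_vanishing_off_def intro: skew_nth)
          consider "f a < f b" | "f b < f a" | "a = b"
            using f by (meson injD linorder_neqE_nat)
          then show ?thesis
          proof cases
            case 1
            then show ?thesis
              using zero by (auto simp: P_def)
          next
            case 2
            then show ?thesis
              using zero skew by (auto simp: P_def)
          next
            case 3
            then show ?thesis
              using skew by (simp add: P_def)
          qed
        qed
        finally show ?thesis .
      qed
      then have "K = (\<Sum>p\<in>P. K $ fst p $ snd p *\<^sub>R g p)"
        by (simp add: vec_eq_iff)
      also have "\<dots> \<in> span (g ` P)"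
        by (intro span_sum span_scale span_base imageI)
      finally show "K \<in> span (g ` P)" .
    qed
  qed
  ultimately have "dim (skew_vanishing_off B) = card P"
    using dim_span_eq_card_independent[of "g ` P"] card_image[of g P] by simp
  then show ?thesis
    using double_card_strict_pairs_off_square[OF f, of B] by (simp add: P_def)
qed

section \<open>Reduction to a basis of the row space\<close>

text \<open>\<open>R\<close> holds the coefficients of every row of \<open>Z\<close> in the basis
  rows, hence its zero columns outside \<open>B\<close>.\<close>

lemma row_basis:
  fixes Z :: "real^'r^'n"
  obtains B R where "card B = rank Z"
    and "\<forall>i j. j \<notin> B \<longrightarrow> R $ i $ j = 0" and "R ** Z = Z"
    and "\<forall>u. (\<Sum>b\<in>B. u b *\<^sub>R Z $ b) = 0 \<longrightarrow> (\<forall>b\<in>B. u b = 0)"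
proof -
  have rows: "rows Z = range (($) Z)"
    by (auto simp: rows_def row_def)
  obtain S where S: "S \<subseteq> rows Z" "independent S" "rows Z \<subseteq> span S" "card S = rank Z"
    using basis_exists[of "rows Z"] unfolding row_rank_def by metis
  \<comment> \<open>Equal rows of \<open>Z\<close> are one element of \<open>rows Z\<close>, so one
    index is chosen for each basis vector.\<close>
  obtain B where B: "inj_on (($) Z) B" "S = ($) Z ` B"
    using S(1) unfolding rows by (metis subset_image_inj)
  have comb: "\<exists>u. Z $ i = (\<Sum>b\<in>B. u b *\<^sub>R Z $ b)" for i
  proof -
    have "Z $ i \<in> span S"
      using S(3) rows by auto
    then obtain v where "Z $ i = (\<Sum>z\<in>S. v z *\<^sub>R z)"
      unfolding span_finite[OF finite_imageI[OF finite, of "($) Z" B], folded B(2)] by auto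
    then have "Z $ i = (\<Sum>b\<in>B. v (Z $ b) *\<^sub>R Z $ b)"
      by (simp add: B(2) sum.reindex[OF B(1)])
    then show ?thesis
      by (intro exI[of _ "\<lambda>b. v (Z $ b)"])
  qed
  then obtain u where u: "\<And>i. Z $ i = (\<Sum>b\<in>B. u i b *\<^sub>R Z $ b)"
    by metis
  define R :: "real^'n^'n" where "R = (\<chi> i j. if j \<in> B then u i j else 0)"
  show thesis
  proof
    show "card B = rank Z"
      using S(4) B by (simp add: card_image)
    show "\<forall>i j. j \<notin> B \<longrightarrow> R $ i $ j = 0"
      by (simp add: R_def)
    have "(R ** Z) $ i $ k = Z $ i $ k" for i k
    proof -
      have "(R ** Z) $ i $ k = (\<Sum>j\<in>UNIV. if j \<in> B then u i j * Z $ j $ k else 0)"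
        by (auto simp: R_def matrix_matrix_mult_def intro!: sum.cong)
      also have "\<dots> = (\<Sum>b\<in>B. u i b *\<^sub>R Z $ b) $ k"
        by (simp flip: sum.inter_restrict)
      finally show ?thesis
        using u[of i] by simp
    qed
    then show "R ** Z = Z"
      by (simp add: vec_eq_iff)
    have "\<forall>b\<in>B. v b = 0" if "(\<Sum>b\<in>B. v b *\<^sub>R Z $ b) = 0" for v
    proof -
      \<comment> \<open>Independence concerns sets of vectors, so coefficients on indices are
        carried over to the rows themselves.\<close>
      define w where "w = (\<lambda>z. v (the_inv_into B (($) Z) z))"
      have w: "w (Z $ b) = v b" if "b \<in> B" for b
        using that by (simp add: w_def the_inv_into_f_f[OF B(1)])
      have "(\<Sum>z\<in>S. w z *\<^sub>R z) = 0"
        using that by (simp add: B(2) sum.reindex[OF B(1)] w)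
      moreover have "finite S"
        by (simp add: B(2))
      ultimately have "\<forall>z\<in>S. w z = 0"
        using S(2) dependent_finite by blast
      then show ?thesis
        using w B(2) by auto
    qed
    then show "\<forall>u. (\<Sum>b\<in>B. u b *\<^sub>R Z $ b) = 0 \<longrightarrow> (\<forall>b\<in>B. u b = 0)"
      by blast
  qed
qed

text \<open>Restricting the map to \<open>skew_vanishing_off B\<close> keeps its image and makes it
  injective, so the dimension is the one already counted. The subtraction does not truncate, since
  the rank is at most the number of rows.\<close>

lemma dim_skew_mult:
  fixes Z :: "real^'r^'n"
  shows "2 * dim ((\<lambda>K. K ** Z) ` {K. transpose K = - K}) + rank Z
           + (CARD('n) - rank Z) ^ 2 = CARD('n) ^ 2"
proof -
  obtain B R where card: "card B = rank Z"
    and R0: "\<forall>i j. j \<notin> B \<longrightarrow> R $ i $ j = 0" and RZ: "R ** Z = Z"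
    and indep: "\<forall>u. (\<Sum>b\<in>B. u b *\<^sub>R Z $ b) = 0 \<longrightarrow> (\<forall>b\<in>B. u b = 0)"
    by (rule row_basis[of Z])
  let ?skew = "{K :: real^'n^'n. transpose K = - K}"
  let ?V = "skew_vanishing_off B"
  have "(\<lambda>K. K ** Z) ` ?skew = (\<lambda>K. K ** Z) ` ?V"
  proof
    show "(\<lambda>K. K ** Z) ` ?skew \<subseteq> (\<lambda>K. K ** Z) ` ?V"
    proof
      fix Y
      assume "Y \<in> (\<lambda>K. K ** Z) ` ?skew"
      then obtain K where K: "transpose K = - K" and Y: "Y = K ** Z"
        by blast
      \<comment> \<open>Since \<open>Q\<close> kills \<open>Z\<close> and is the identity in the columns outside \<open>B\<close>, subtracting
        \<open>Q\<^sup>T K Q\<close> clears the block of \<open>K\<close> outside \<open>B\<close> without changing \<open>K Z\<close>.\<close>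
      define Q where "Q = mat 1 - R"
      define K' where "K' = K - transpose Q ** K ** Q"
      have QZ: "Q ** Z = 0"
        using linear_diff[OF linear_matrix_mult_left[of Z], of "mat 1" R] by (simp add: Q_def RZ)
      have "K' ** Z = K ** Z - transpose Q ** K ** (Q ** Z)"
        using linear_diff[OF linear_matrix_mult_left[of Z], of K "transpose Q ** K ** Q"]
        by (simp add: K'_def matrix_mul_assoc)
      then have "K' ** Z = Y"
        by (simp add: QZ Y)
      moreover have "K' \<in> ?V"
      proof -
        have "transpose (transpose Q ** K ** Q) = - (transpose Q ** K ** Q)"
          using linear_neg[OF linear_matrix_mult_left[of Q], of "transpose Q ** K"]
            linear_neg[OF linear_matrix_mult_right[of "transpose Q"], of K]
          by (simp add: matrix_transpose_mul matrix_mul_assoc K)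
        then have "transpose K' = - K'"
          using K by (simp add: K'_def linear_diff[OF linear_transpose])
        moreover have "(transpose Q ** K ** Q) $ i $ j = K $ i $ j" if "i \<notin> B" "j \<notin> B" for i j
        proof -
          have Qcol: "Q $ a $ c = (if a = c then 1 else 0)" if "c \<notin> B" for a c
            using R0 that by (simp add: Q_def mat_def)
          show ?thesis
            using that by (simp add: matrix_matrix_mult_def transpose_def Qcol
                if_distrib[where f = "\<lambda>x. x * c" for c] if_distrib[where f = "\<lambda>x. c * x" for c]
                cong: if_cong)
        qed
        ultimately show ?thesis
          by (simp add: skew_vanishing_off_def K'_def)
      qed
      ultimately show "Y \<in> (\<lambda>K. K ** Z) ` ?V"
        by blast
    qed
    show "(\<lambda>K. K ** Z) ` ?V \<subseteq> (\<lambda>K. K ** Z) ` ?skew"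
      by (auto simp: skew_vanishing_off_def)
  qed
  moreover have "dim ((\<lambda>K. K ** Z) ` ?V) = dim ?V"
  proof (rule dim_image_eq)
    show "linear (\<lambda>K. K ** Z)"
      by (rule linear_matrix_mult_left)
    have "K = 0" if "K \<in> ?V" "K ** Z = 0" for K
    proof -
      have skew: "K $ i $ j = - K $ j $ i" and zero: "i \<notin> B \<Longrightarrow> j \<notin> B \<Longrightarrow> K $ i $ j = 0" for i j
        using that(1) by (auto simp: skew_vanishing_off_def intro: skew_nth)
      have sum_row: "(\<Sum>j\<in>UNIV. K $ i $ j *\<^sub>R Z $ j) = 0" for i
        using that(2) by (simp add: vec_eq_iff matrix_matrix_mult_def)
      \<comment> \<open>A row of \<open>K\<close> supported in \<open>B\<close> is a linear relation
        among the independent rows of \<open>Z\<close>.\<close>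
      have row0: "K $ i $ b = 0" if out: "\<And>j. j \<notin> B \<Longrightarrow> K $ i $ j = 0" and "b \<in> B" for i b
      proof -
        have "(\<Sum>j\<in>B. K $ i $ j *\<^sub>R Z $ j) = (\<Sum>j\<in>UNIV. K $ i $ j *\<^sub>R Z $ j)"
          by (rule sum.mono_neutral_left) (auto simp: out)
        then show ?thesis
          using indep sum_row that by metis
      qed
      \<comment> \<open>First the rows outside \<open>B\<close> vanish, being supported in
        \<open>B\<close> by definition of the space. By skewness the columns outside
        \<open>B\<close> vanish too, so \<open>row0\<close> also applies to the rows in
        \<open>B\<close>.\<close>
      have "K $ i $ j = 0" for i j
        by (metis add.inverse_neutral row0 skew zero)
      then show ?thesis
        by (simp add: vec_eq_iff)
    qed
    then show "inj_on (\<lambda>K. K ** Z) (span ?V)"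
      using linear_inj_on_iff_eq_0[OF linear_matrix_mult_left subspace_skew_vanishing_off, of Z B]
      by (simp add: span_eq_iff[THEN iffD2, OF subspace_skew_vanishing_off])
  qed
  moreover have "card (- B) = CARD('n) - rank Z"
    by (simp add: Compl_eq_Diff_UNIV card_Diff_subset card)
  ultimately show ?thesis
    using dim_skew_vanishing_off[of B] card by simp
qed

section \<open>Linear vector fields\<close>

lemma times_cont_differentiable_const: "times_cont_differentiable k (\<lambda>x. c)"
  by (induction k arbitrary: c) auto

lemma frechet_derivative_linear:
  fixes f :: "'a::euclidean_space \<Rightarrow> 'b::real_normed_vector"
  assumes "linear f"
  shows "frechet_derivative f (at x) = f"
  using assms by (metis bounded_linear_imp_has_derivative frechet_derivative_at linear_conv_bounded_linear)

text \<open>The derivative does not depend on the point, so each directional derivative is constant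
  and no induction on the order is needed.\<close>

lemma smooth_linear:
  fixes f :: "'a::euclidean_space \<Rightarrow> 'b::real_normed_vector"
  assumes "linear f"
  shows "smooth f"
proof -
  have f: "bounded_linear f"
    using assms by (simp add: linear_conv_bounded_linear)
  have "times_cont_differentiable k f" for k
  proof (cases k)
    case 0
    then show ?thesis
      using f by (simp add: linear_continuous_on)
  next
    case (Suc k')
    then show ?thesis
      by (simp add: frechet_derivative_linear[OF assms] times_cont_differentiable_const
          bounded_linear_imp_differentiable[OF f])
  qed
  then show ?thesis
    by (simp add: smooth_def)
qed

lemma gradient_eqI:
  assumes "GDERIV f x :> D"
  shows "gradient f x = D"
  unfolding gradient_def
proof (rule the_equality[where P = "\<lambda>D. GDERIV f x :> D", OF assms])
  fix D'
  assume "GDERIV f x :> D'"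
  then have "(\<lambda>h. inner h D') = (\<lambda>h. inner h D)"
    using assms unfolding gderiv_def by (rule has_derivative_unique)
  then show "D' = D"
    by (simp add: fun_eq_iff vector_eq_ldot)
qed

definition linear_field :: "real^'i^'i \<Rightarrow> real^'r^'i \<Rightarrow> real^'r^'i"
  where "linear_field A = (\<lambda>\<theta>. A ** \<theta>)"

text \<open>Linearity is in the matrix, not in the point: subspaces can thus be moved between
  matrices and vector fields.\<close>

lemma linear_linear_field: "linear (linear_field :: real^'i^'i \<Rightarrow> real^'r^'i \<Rightarrow> real^'r^'i)"
  by (rule linearI)
    (simp_all add: linear_field_def fun_eq_iff scaleR_fun_def
      linear_add[OF linear_matrix_mult_left] linear_cmul[OF linear_matrix_mult_left])

lemma lie_bracket_linear_field:
  "lie_bracket (linear_field A) (linear_field B) = linear_field (A ** B - B ** A)"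
  by (simp add: lie_bracket_def linear_field_def fun_eq_iff matrix_mul_assoc
      frechet_derivative_linear[OF linear_matrix_mult_right] linear_diff[OF linear_matrix_mult_left])

lemma matrix_unit_mult_nth:
  "(matrix_unit i j ** \<theta>) $ a = (if a = i then \<theta> $ j else 0)" for \<theta> :: "real^'r^'j"
proof -
  have "(matrix_unit i j ** \<theta>) $ a $ b = (if a = i then \<theta> $ j else 0) $ b" for b
  proof -
    have "(matrix_unit i j ** \<theta>) $ a $ b = (\<Sum>c\<in>UNIV. if c = j then (if a = i then \<theta> $ j $ b else 0) else 0)"
      unfolding matrix_matrix_mult_def vec_lambda_beta by (rule sum.cong) (auto simp: matrix_unit_nth)
    then show ?thesis
      by simp
  qed
  then show ?thesis
    by (simp add: vec_eq_iff)
qed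

lemma inner_matrix_unit_mult:
  "inner h (matrix_unit i j ** \<theta>) = inner (h $ i) (\<theta> $ j)" for \<theta> :: "real^'r^'j"
proof -
  have "inner h (matrix_unit i j ** \<theta>) = (\<Sum>a\<in>UNIV. if a = i then inner (h $ i) (\<theta> $ j) else 0)"
    unfolding inner_vec_def[of h] by (rule sum.cong) (auto simp: matrix_unit_mult_nth)
  then show ?thesis
    by simp
qed

definition swap_unit :: "'n::finite \<Rightarrow> 'm::finite \<Rightarrow> real^('n + 'm)^('n + 'm)"
  where "swap_unit k l = matrix_unit (Inl k) (Inr l) + matrix_unit (Inr l) (Inl k)"

text \<open>The entry is the inner product of row \<open>k\<close> of the upper block with row
  \<open>l\<close> of the lower one. Its gradient therefore puts each of these rows in the place of
  the other.\<close>

lemma gradient_factorization: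
  "gradient (on_concat (\<lambda>(U :: real^'r^'n) (V :: real^'r^'m). factorization U V $ k $ l))
     = linear_field (swap_unit k l)"
proof
  fix \<theta> :: "real^'r^('n + 'm)"
  have eq: "on_concat (\<lambda>(U :: real^'r^'n) (V :: real^'r^'m). factorization U V $ k $ l)
      = (\<lambda>\<theta>. inner (\<theta> $ Inl k) (\<theta> $ Inr l))"
    by (simp add: fun_eq_iff on_concat_def factorization_def upper_block_def lower_block_def
        matrix_matrix_mult_def transpose_def inner_vec_def)
  have "((\<lambda>\<theta>. inner (\<theta> $ Inl k) (\<theta> $ Inr l)) has_derivative
      (\<lambda>h. inner (\<theta> $ Inl k) (h $ Inr l) + inner (h $ Inl k) (\<theta> $ Inr l))) (at \<theta>)"
    by (intro has_derivative_inner bounded_linear_imp_has_derivative bounded_linear_vec_nth)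
  moreover have "inner h (linear_field (swap_unit k l) \<theta>)
      = inner (\<theta> $ Inl k) (h $ Inr l) + inner (h $ Inl k) (\<theta> $ Inr l)" for h
    by (simp add: linear_field_def swap_unit_def linear_add[OF linear_matrix_mult_left]
        inner_add_right inner_matrix_unit_mult inner_commute)
  ultimately show "gradient (on_concat (\<lambda>(U :: real^'r^'n) (V :: real^'r^'m).
      factorization U V $ k $ l)) \<theta> = linear_field (swap_unit k l) \<theta>"
    unfolding eq by (intro gradient_eqI) (simp add: gderiv_def)
qed

section \<open>The pseudo-orthogonal Lie algebra\<close>

definition block_sign :: "'n + 'm \<Rightarrow> real"
  where "block_sign i = (case i of Inl _ \<Rightarrow> 1 | Inr _ \<Rightarrow> -1)"

lemma block_sign_simps [simp]: "block_sign (Inl a) = 1" "block_sign (Inr b) = -1"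
  by (simp_all add: block_sign_def)

lemma block_sign_square [simp]: "block_sign i * block_sign i = 1"
  by (cases i) simp_all

definition signature :: "real^('n::finite + 'm::finite)^('n + 'm)"
  where "signature = (\<chi> i j. if i = j then block_sign i else 0)"

lemma transpose_signature: "transpose signature = signature"
  unfolding vec_eq_iff
proof (intro allI)
  fix i j
  show "transpose signature $ i $ j = signature $ i $ j"
    by (cases "i = j") (simp_all add: signature_def transpose_def)
qed

lemma signature_mult_nth: "(signature ** M) $ i $ j = block_sign i * M $ i $ j"
proof -
  have "(signature ** M) $ i $ j = (\<Sum>k\<in>UNIV. if k = i then block_sign i * M $ i $ j else 0)"
    unfolding matrix_matrix_mult_def vec_lambda_beta by (rule sum.cong) (auto simp: signature_def)
  then show ?thesis
    by simp
qed

lemma signature_mult_signature_mult [simp]: "signature ** (signature ** M) = M"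
  by (simp add: vec_eq_iff signature_mult_nth flip: mult.assoc)

text \<open>The Lie algebra \<open>\<ss>\<oo>(n, m)\<close> of the quadratic form with matrix \<^const>\<open>signature\<close>.\<close>

definition pseudo_orthogonal :: "(real^('n::finite + 'm::finite)^('n + 'm)) set"
  where "pseudo_orthogonal = {M. transpose (signature ** M) = - (signature ** M)}"

lemma subspace_pseudo_orthogonal: "subspace pseudo_orthogonal"
  by (rule subspaceI)
    (simp_all add: pseudo_orthogonal_def linear_0[OF linear_transpose] linear_add[OF linear_transpose]
      linear_cmul[OF linear_transpose] linear_add[OF linear_matrix_mult_right]
      linear_cmul[OF linear_matrix_mult_right])

text \<open>Moving the transpose past both factors costs two signs, which cancel:
  \<open>J A B\<close> transposes to \<open>J B A\<close>. The commutator therefore changes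
  sign.\<close>

lemma pseudo_orthogonal_commutator:
  assumes "M \<in> pseudo_orthogonal" "N \<in> pseudo_orthogonal"
  shows "M ** N - N ** M \<in> pseudo_orthogonal"
proof -
  let ?J = "signature :: real^('a + 'b)^('a + 'b)"
  have M: "transpose M ** ?J = - (?J ** M)" and N: "transpose N ** ?J = - (?J ** N)"
    using assms by (simp_all add: pseudo_orthogonal_def matrix_transpose_mul transpose_signature)
  have prod: "transpose (?J ** (A ** B)) = ?J ** (B ** A)"
    if "transpose A ** ?J = - (?J ** A)" "transpose B ** ?J = - (?J ** B)" for A B
  proof -
    have "transpose (?J ** (A ** B)) = transpose B ** (transpose A ** ?J)"
      by (simp add: matrix_transpose_mul transpose_signature matrix_mul_assoc)
    also have "\<dots> = - ((transpose B ** ?J) ** A)"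
      by (simp add: that(1) linear_neg[OF linear_matrix_mult_right] matrix_mul_assoc)
    also have "\<dots> = ?J ** (B ** A)"
      by (simp add: that(2) linear_neg[OF linear_matrix_mult_left] matrix_mul_assoc)
    finally show ?thesis .
  qed
  show ?thesis
    by (simp add: pseudo_orthogonal_def linear_diff[OF linear_matrix_mult_right]
        linear_diff[OF linear_transpose] prod[OF M N] prod[OF N M])
qed

lemma swap_unit_pseudo_orthogonal: "swap_unit k l \<in> pseudo_orthogonal"
proof -
  have "signature ** swap_unit k l = matrix_unit (Inl k) (Inr l) - matrix_unit (Inr l) (Inl k)"
    by (simp add: vec_eq_iff signature_mult_nth swap_unit_def matrix_unit_nth)
  then show ?thesis
    by (simp add: pseudo_orthogonal_def linear_diff[OF linear_transpose] transpose_matrix_unit)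
qed

section \<open>Generation of the pseudo-orthogonal algebra by the swap units\<close>

text \<open>The common index links the two factors through the opposite block. For equal outer
  indices the products also contain a diagonal unit, which cancels.\<close>

lemma swap_unit_commutators:
  "swap_unit a l ** swap_unit b l - swap_unit b l ** swap_unit a l
     = matrix_unit (Inl a) (Inl b) - matrix_unit (Inl b) (Inl a)"
  "swap_unit k c ** swap_unit k d - swap_unit k d ** swap_unit k c
     = matrix_unit (Inr c) (Inr d) - matrix_unit (Inr d) (Inr c)"
  by (simp_all add: swap_unit_def linear_add[OF linear_matrix_mult_left]
      linear_add[OF linear_matrix_mult_right] matrix_unit_mult)

text \<open>This is the minimality half of the generation claim, kept at the level of matrices.
  Entries within a block come from commutators, those between blocks from the swap units
  themselves.\<close>

lemma pseudo_orthogonal_induct: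
  assumes M: "M \<in> pseudo_orthogonal" and S: "subspace S"
    and commutator: "\<And>A B. A \<in> S \<Longrightarrow> B \<in> S \<Longrightarrow> A ** B - B ** A \<in> S"
    and swap: "\<And>k l. swap_unit k l \<in> S"
  shows "M \<in> S"
proof -
  \<comment> \<open>\<open>G i j\<close> is twice the projection of \<open>matrix_unit i j\<close>
    onto the algebra, the projection being half of \<open>M\<close> minus
    \<open>J M^T J\<close>.\<close>
  define G where "G i j = matrix_unit i j - (block_sign i * block_sign j) *\<^sub>R matrix_unit j i"
    for i j :: "'a + 'b"
  have G: "G i j \<in> S" for i j
  proof (cases i; cases j)
    fix a b
    assume "i = Inl a" "j = Inl b"
    \<comment> \<open>Any index of the other block serves as the common one.\<close>
    then show ?thesis
      using commutator[OF swap[of a] swap[of b]] swap_unit_commutators(1)[of a _ b]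
      by (metis G_def block_sign_square block_sign_simps(1) scaleR_one)
  next
    fix c d
    assume "i = Inr c" "j = Inr d"
    then show ?thesis
      using commutator[OF swap[of _ c] swap[of _ d]] swap_unit_commutators(2)[of _ c d]
      by (metis G_def block_sign_square block_sign_simps(2) scaleR_one)
  next
    fix k l
    assume "i = Inl k" "j = Inr l"
    then show ?thesis
      using swap[of k l] by (simp add: G_def swap_unit_def)
  next
    fix k l
    assume "i = Inr l" "j = Inl k"
    then show ?thesis
      using swap[of k l] by (simp add: G_def swap_unit_def add.commute)
  qed
  have nth: "(block_sign i * block_sign j) * M $ i $ j = - M $ j $ i" for i j
  proof -
    have "block_sign i * M $ i $ j = - (block_sign j * M $ j $ i)"
      using skew_nth[of "signature ** M" i j] M by (simp add: pseudo_orthogonal_def signature_mult_nth)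
    then show ?thesis
      by (cases i; cases j) simp_all
  qed
  \<comment> \<open>As \<open>M\<close> is fixed by the projection, the combination of the
    \<open>G i j\<close> with its entries gives \<open>M\<close> twice.\<close>
  have "(\<Sum>i\<in>UNIV. \<Sum>j\<in>UNIV. M $ i $ j *\<^sub>R G i j)
      = (\<Sum>i\<in>UNIV. \<Sum>j\<in>UNIV. M $ i $ j *\<^sub>R matrix_unit i j)
      + (\<Sum>i\<in>UNIV. \<Sum>j\<in>UNIV. M $ j $ i *\<^sub>R matrix_unit j i)"
    unfolding sum.distrib[symmetric]
  proof (intro sum.cong refl)
    fix i j
    have "M $ i $ j *\<^sub>R (block_sign i * block_sign j) *\<^sub>R matrix_unit j i = - (M $ j $ i *\<^sub>R matrix_unit j i)"
      using nth[of i j] by (simp add: mult.commute)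
    then show "M $ i $ j *\<^sub>R G i j = M $ i $ j *\<^sub>R matrix_unit i j + M $ j $ i *\<^sub>R matrix_unit j i"
      by (simp add: G_def scaleR_diff_right)
  qed
  also have "(\<Sum>i\<in>UNIV. \<Sum>j\<in>UNIV. M $ j $ i *\<^sub>R matrix_unit j i)
      = (\<Sum>i\<in>UNIV. \<Sum>j\<in>UNIV. M $ i $ j *\<^sub>R matrix_unit i j)"
    by (rule sum.swap)
  finally have "(1 / 2) *\<^sub>R (\<Sum>i\<in>UNIV. \<Sum>j\<in>UNIV. M $ i $ j *\<^sub>R G i j) = M"
    by (simp only: sum_matrix_unit[symmetric] scaleR_half_double)
  moreover have "(1 / 2) *\<^sub>R (\<Sum>i\<in>UNIV. \<Sum>j\<in>UNIV. M $ i $ j *\<^sub>R G i j) \<in> S"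
    by (intro subspace_scale subspace_sum S G)
  ultimately show ?thesis
    by simp
qed

section \<open>The Lie algebra generated by the gradient fields\<close>

lemma lie_generated_factorization:
  "lie_generated (gradient_fields (factorization :: real^'r^'n \<Rightarrow> real^'r^'m \<Rightarrow> real^'m^'n))
     = linear_field ` pseudo_orthogonal"
  unfolding lie_generated_def
proof (rule hull_unique)
  have gradients: "{gradient (on_concat (\<lambda>(U :: real^'r^'n) (V :: real^'r^'m). factorization U V $ k $ l)) |k l. True}
      = {linear_field (swap_unit k l) |k l. True}"
    by (simp add: gradient_factorization)
  have sub: "subspace (linear_field ` pseudo_orthogonal :: (real^'r^('n + 'm) \<Rightarrow> _) set)"
    by (rule linear_subspace_image[OF linear_linear_field subspace_pseudo_orthogonal])
  show "gradient_fields (factorization :: real^'r^'n \<Rightarrow> real^'r^'m \<Rightarrow> real^'m^'n)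
      \<subseteq> linear_field ` pseudo_orthogonal"
    unfolding gradient_fields_def gradients
    by (rule span_minimal[OF _ sub]) (use swap_unit_pseudo_orthogonal in blast)
  show "lie_subalgebra (linear_field ` pseudo_orthogonal :: (real^'r^('n + 'm) \<Rightarrow> _) set)"
    unfolding lie_subalgebra_def
  proof (intro conjI ballI sub)
    show "linear_field ` pseudo_orthogonal \<subseteq> {X :: real^'r^('n + 'm) \<Rightarrow> _. smooth X}"
      by (auto simp: linear_field_def intro: smooth_linear linear_matrix_mult_right)
    fix X Y :: "real^'r^('n + 'm) \<Rightarrow> _"
    assume "X \<in> linear_field ` pseudo_orthogonal" "Y \<in> linear_field ` pseudo_orthogonal"
    then show "lie_bracket X Y \<in> linear_field ` pseudo_orthogonal"
      by (auto simp: lie_bracket_linear_field pseudo_orthogonal_commutator)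
  qed
  fix L :: "(real^'r^('n + 'm) \<Rightarrow> _) set"
  assume "gradient_fields (factorization :: real^'r^'n \<Rightarrow> real^'r^'m \<Rightarrow> real^'m^'n) \<subseteq> L" and L: "lie_subalgebra L"
  then have swap: "linear_field (swap_unit k l) \<in> L" for k l
    unfolding gradient_fields_def gradients by (blast intro: span_base)
  show "linear_field ` pseudo_orthogonal \<subseteq> L"
  proof (rule image_subsetI)
    fix M :: "real^('n + 'm)^('n + 'm)"
    assume "M \<in> pseudo_orthogonal"
    \<comment> \<open>The preimage of \<open>L\<close> is a subspace of matrices closed under
      commutators, because brackets of linear fields are commutators.\<close>
    then have "M \<in> linear_field -` L"
    proof (rule pseudo_orthogonal_induct)
      show "subspace (linear_field -` L)"
        using L by (intro linear_subspace_vimage linear_linear_field) (simp add: lie_subalgebra_def)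
      show "A ** B - B ** A \<in> linear_field -` L" if "A \<in> linear_field -` L" "B \<in> linear_field -` L" for A B
        using L that by (simp add: lie_subalgebra_def flip: lie_bracket_linear_field)
      show "swap_unit k l \<in> linear_field -` L" for k l
        using swap by simp
    qed
    then show "linear_field M \<in> L"
      by simp
  qed
qed

section \<open>Dimension of the trace\<close>

text \<open>Left multiplication by \<open>signature\<close> is an involution, so it preserves
  dimension, and it turns the algebra into the skew matrices.\<close>

lemma dim_pseudo_orthogonal_mult:
  fixes Z :: "real^'r^('n::finite + 'm::finite)"
  shows "2 * dim ((\<lambda>M. M ** Z) ` pseudo_orthogonal) + rank Z
           + (CARD('n) + CARD('m) - rank Z) ^ 2 = (CARD('n) + CARD('m)) ^ 2"
proof -
  let ?J = "signature :: real^('n + 'm)^('n + 'm)"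
  let ?T = "(\<lambda>M. M ** Z) ` pseudo_orthogonal"
  have "(**) ?J ` ?T = (\<lambda>K. K ** Z) ` {K. transpose K = - K}"
  proof
    show "(**) ?J ` ?T \<subseteq> (\<lambda>K. K ** Z) ` {K. transpose K = - K}"
      by (auto simp: pseudo_orthogonal_def matrix_mul_assoc)
    show "(\<lambda>K. K ** Z) ` {K. transpose K = - K} \<subseteq> (**) ?J ` ?T"
    proof (rule image_subsetI)
      fix K :: "real^('n + 'm)^('n + 'm)"
      assume "K \<in> {K. transpose K = - K}"
      then have "?J ** K \<in> pseudo_orthogonal"
        by (simp add: pseudo_orthogonal_def)
      moreover have "K ** Z = ?J ** ((?J ** K) ** Z)"
        by (simp flip: matrix_mul_assoc)
      ultimately show "K ** Z \<in> (**) ?J ` ?T"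
        by blast
    qed
  qed
  moreover have "dim ((**) ?J ` ?T) = dim ?T"
  proof (rule dim_image_eq)
    show "linear ((**) ?J :: real^'r^('n + 'm) \<Rightarrow> _)"
      by (rule linear_matrix_mult_right)
    show "inj_on ((**) ?J) (span ?T)"
      by (rule inj_on_inverseI[where g = "(**) ?J"]) simp
  qed
  ultimately show ?thesis
    using dim_skew_mult[of Z] by simp
qed

theorem proposition4p3:
  fixes U :: "real^'r^'n" and V :: "real^'r^'m" and rk :: nat
  assumes "rk = rank (vconcat U V)"
    and full_rank: "rank (vconcat U V) = min (CARD('n) + CARD('m)) CARD('r)"
  shows "real (dim (trace_at
           (lie_generated (gradient_fields
              (factorization :: real^'r^'n \<Rightarrow> real^'r^'m \<Rightarrow> real^'m^'n)))
           (vconcat U V)))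
       = (real CARD('n) + real CARD('m)) * real CARD('r)
         - real rk * (2 * real CARD('r) + 1 - real rk) / 2"
proof -
  let ?Z = "vconcat U V"
  let ?T = "(\<lambda>M. M ** ?Z) ` pseudo_orthogonal"
  let ?N = "CARD('n) + CARD('m)"
  have "trace_at (linear_field ` pseudo_orthogonal) ?Z = span ?T"
    unfolding trace_at_def by (rule arg_cong[where f = span]) (auto simp: linear_field_def)
  then have trace: "dim (trace_at (lie_generated (gradient_fields
      (factorization :: real^'r^'n \<Rightarrow> real^'r^'m \<Rightarrow> real^'m^'n))) ?Z) = dim ?T"
    by (simp add: lie_generated_factorization)
  have rk: "rk \<le> ?N" "rk = ?N \<or> rk = CARD('r)"
    using assms by (auto simp: min_def)
  have "2 * dim ?T + rk + (?N - rk) ^ 2 = ?N ^ 2"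
    using dim_pseudo_orthogonal_mult[of ?Z] assms(1) by simp
  then have "real (2 * dim ?T + rk + (?N - rk) ^ 2) = real (?N ^ 2)"
    by (rule arg_cong)
  then have "2 * real (dim ?T) + real rk + (real ?N - real rk) ^ 2 = real ?N ^ 2"
    using rk(1) by (simp add: of_nat_diff)
  \<comment> \<open>The count amounts to \<open>2 dim T = rk (2 N - 1 - rk)\<close>. Twice the
    claimed value exceeds this by \<open>2 (N - rk) (r - rk)\<close>, which full rank makes
    zero.\<close>
  moreover have "(real ?N - real rk) * (real CARD('r) - real rk) = 0"
    using rk(2) by auto
  ultimately have "2 * real (dim ?T) = 2 * real ?N * real CARD('r) - real rk * (2 * real CARD('r) + 1 - real rk)"
    by algebra
  then show ?thesis
    unfolding trace by (simp add: field_simps)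
qed

end
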